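(* Let $X$ be a compact metric space. If there exists a distal homeomorphism $f:X\to X$ with the pseudo-orbit tracing property (POTP), then $X$ is totally disconnected.
   Context: Let $f:X\to X$ be a homeomorphism of a metric space $(X,d)$. For $\delta>0$, a bi-infinite sequence $\xi=(\xi_n)_{n\in\mathbb{Z}}$ of points of $X$ is a $\delta$-pseudo-orbit if $d(f(\xi_n),\xi_{n+1})\leq\delta$ for all $n\in\mathbb{Z}$. For $\epsilon>0$, $\xi$ can be $\epsilon$-shadowed if there is $x\in X$ such that $d(f^n(x),\xi_n)\leq\epsilon$ for all $n\in\mathbb{Z}$. $f$ has the POTP if for every $\epsilon>0$ there is $\delta>0$ such that every $\delta$-pseudo-orbit can be $\epsilon$-shadowed. The homeomorphism $f$ is distal if $\inf_{n\in\mathbb{Z}}d(f^n(x),f^n(y))>0$ for all distinct points $x,y\in X$. $X$ is totally disconnected if for every $p\in X$ the connected component of $X$ containing $p$ is $\{p\}$. *)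

theory Defs
  imports "HOL-Analysis.Analysis"
begin

text \<open>
  The space is a subset \<open>X\<close> of a metric type, with the restricted metric and the subspace topology.
  Maps are total on the type, but only their behaviour on \<open>X\<close> matters.
\<close>

definition self_homeomorphism :: "'a::metric_space set \<Rightarrow> ('a \<Rightarrow> 'a) \<Rightarrow> bool" where
  "self_homeomorphism X f \<longleftrightarrow> (\<exists>g. homeomorphism X X f g)"

text \<open>
  The iterate \<open>f\<^sup>n\<close> for an integer \<open>n\<close>, where negative iterates use the inverse of the bijection
  that \<open>f\<close> induces on \<open>X\<close>; meaningful only at points of \<open>X\<close>.
\<close>

definition int_iterate :: "'a set \<Rightarrow> ('a \<Rightarrow> 'a) \<Rightarrow> int \<Rightarrow> 'a \<Rightarrow> 'a" where
  "int_iterate X f n =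
     (if 0 \<le> n then f ^^ nat n else inv_into X f ^^ nat (- n))"

definition pseudo_orbit ::
    "'a::metric_space set \<Rightarrow> ('a \<Rightarrow> 'a) \<Rightarrow> real \<Rightarrow> (int \<Rightarrow> 'a) \<Rightarrow> bool" where
  "pseudo_orbit X f \<delta> \<xi> \<longleftrightarrow>
     (\<forall>n. \<xi> n \<in> X) \<and> (\<forall>n. dist (f (\<xi> n)) (\<xi> (n + 1)) \<le> \<delta>)"

definition can_be_shadowed ::
    "'a::metric_space set \<Rightarrow> ('a \<Rightarrow> 'a) \<Rightarrow> real \<Rightarrow> (int \<Rightarrow> 'a) \<Rightarrow> bool" where
  "can_be_shadowed X f \<epsilon> \<xi> \<longleftrightarrow>
     (\<exists>x\<in>X. \<forall>n. dist (int_iterate X f n x) (\<xi> n) \<le> \<epsilon>)"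

definition POTP :: "'a::metric_space set \<Rightarrow> ('a \<Rightarrow> 'a) \<Rightarrow> bool" where
  "POTP X f \<longleftrightarrow>
     (\<forall>\<epsilon>>0. \<exists>\<delta>>0. \<forall>\<xi>. pseudo_orbit X f \<delta> \<xi> \<longrightarrow> can_be_shadowed X f \<epsilon> \<xi>)"

definition distal :: "'a::metric_space set \<Rightarrow> ('a \<Rightarrow> 'a) \<Rightarrow> bool" where
  "distal X f \<longleftrightarrow>
     (\<forall>x\<in>X. \<forall>y\<in>X. x \<noteq> y \<longrightarrow>
        (INF n::int. dist (int_iterate X f n x) (int_iterate X f n y)) > 0)"

definition totally_disconnected :: "'a::topological_space set \<Rightarrow> bool" where
  "totally_disconnected X \<longleftrightarrow> (\<forall>p\<in>X. connected_component_set X p = {p})"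

end

theory Submission
  imports Defs
begin

text \<open>
  Distality forces recurrence: for a distal \<open>f\<close> on a compact space and finitely many points there
  are arbitrarily large \<open>n\<close> for which \<open>f\<^sup>n\<close> moves all of these points by as little as desired
  (\<open>distal_simultaneous_recurrence\<close>). This is Ellis' argument. The pointwise limits of the powers
  of \<open>f\<close> form a compact semigroup of maps, which contains an idempotent \<open>u\<close>. For every \<open>x\<close> the points
  \<open>x\<close> and \<open>u x\<close> have the same image under \<open>u\<close>, so some power of \<open>f\<close> brings them as close together
  as desired; by distality \<open>u x = x\<close>, and thus the identity is a limit of powers of \<open>f\<close>. The inverse
  of \<open>f\<close> is distal as well, so the same holds for it.

  Let \<open>p\<close> and \<open>b\<close> lie in one connected component of \<open>X\<close>. Recurrence lets a pseudo-orbit return close to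
  the point that it started from and then jump to a slightly different one. Small steps inside the
  component lead from \<open>p\<close> to \<open>b\<close>, so there is a pseudo-orbit that agrees with the orbit of \<open>p\<close> up to
  time \<open>0\<close> and is at \<open>b\<close> at some time \<open>N\<close>, which can be chosen such that \<open>f\<^sup>N p\<close> is close to \<open>p\<close>
  (\<open>pseudo_orbit_along_connected\<close>). A point \<open>x\<close> that shadows it is close to \<open>p\<close> throughout the past.
  Under backward recurrence the pair \<open>(f\<^sup>N x, f\<^sup>N p)\<close> returns close to itself at a nonpositive time of
  the two orbits, where they are close to each other. Hence \<open>f\<^sup>N x\<close>, which is close to \<open>b\<close>, is close to
  \<open>f\<^sup>N p\<close>, which is close to \<open>p\<close>. As the errors are arbitrary, \<open>b = p\<close>.
\<close>

section \<open>Idempotents in compact semigroups of maps\<close>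

text \<open>
  Function spaces carry the topology of pointwise convergence, in which maps into a Hausdorff space
  form a Hausdorff space.
\<close>

lemma compact_imp_closed_maps:
  fixes S :: "('a \<Rightarrow> 'b::t2_space) set"
  assumes "compact S"
  shows "closed S"
proof -
  have "Hausdorff_space (euclidean :: 'b topology)"
    unfolding Hausdorff_space_def disjnt_def using hausdorff by fastforce
  then have "Hausdorff_space (product_topology (\<lambda>i::'a. euclidean::'b topology) UNIV)"
    by (simp add: Hausdorff_space_product_topology)
  then have "Hausdorff_space (euclidean :: ('a \<Rightarrow> 'b) topology)"
    by (simp add: euclidean_product_topology)
  then show ?thesis
    using assms compactin_imp_closedin by fastforce
qed

text \<open>
  Composition is continuous in its left argument for an arbitrary, possibly discontinuous right
  argument: the value of \<open>q \<circ> p\<close> at \<open>x\<close> is the coordinate of \<open>q\<close> at \<open>p x\<close>.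
\<close>

lemma continuous_on_comp_right: "continuous_on S (\<lambda>q::'b \<Rightarrow> 'c::topological_space. q \<circ> p)"
  by (intro continuous_on_coordinatewise_then_product)
    (auto intro: continuous_on_subset[OF continuous_on_product_coordinates])

text \<open>
  Zorn's lemma applies to the compact subsemigroups ordered by reverse inclusion: by compactness, a
  chain of them has a nonempty intersection.
\<close>

lemma compact_semigroup_minimal:
  fixes S :: "('a \<Rightarrow> 'a::t2_space) set"
  assumes "compact S" "S \<noteq> {}" "\<And>u v. u \<in> S \<Longrightarrow> v \<in> S \<Longrightarrow> u \<circ> v \<in> S"
  obtains M where "M \<subseteq> S" "compact M" "M \<noteq> {}" "\<And>u v. u \<in> M \<Longrightarrow> v \<in> M \<Longrightarrow> u \<circ> v \<in> M"
    and "\<And>N. N \<subseteq> M \<Longrightarrow> compact N \<Longrightarrow> N \<noteq> {} \<Longrightarrow> (\<And>u v. u \<in> N \<Longrightarrow> v \<in> N \<Longrightarrow> u \<circ> v \<in> N) \<Longrightarrow> N = M"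
proof -
  define A where "A = {T. T \<subseteq> S \<and> compact T \<and> T \<noteq> {} \<and> (\<forall>u\<in>T. \<forall>v\<in>T. u \<circ> v \<in> T)}"
  have SA: "S \<in> A"
    using assms by (auto simp: A_def)
  have "\<exists>M\<in>A. \<forall>N\<in>A. N \<subseteq> M \<longrightarrow> N = M"
  proof (rule predicate_Zorn)
    show "partial_order_on A (relation_of (\<lambda>M N. N \<subseteq> M) A)"
      by (rule partial_order_on_relation_ofI) auto
  next
    fix C assume C: "C \<in> Chains (relation_of (\<lambda>M N. N \<subseteq> M) A)"
    then have CA: "C \<subseteq> A"
      by (rule Chains_relation_of)
    have chain: "M \<subseteq> N \<or> N \<subseteq> M" if "M \<in> C" "N \<in> C" for M N
      using C that unfolding Chains_def relation_of_def by auto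
    have closedC: "closed T" if "T \<in> C" for T
      using that CA compact_imp_closed_maps by (auto simp: A_def)
    \<comment> \<open>Intersecting with \<open>S\<close> covers the empty chain, whose intersection would be all maps.\<close>
    have ClC: "S \<inter> \<Inter>F \<in> insert S C" if "finite F" "F \<subseteq> C" for F
      using that
    proof induction
      case (insert T F)
      then have "S \<inter> \<Inter>F \<in> insert S C" "T \<in> C" "T \<subseteq> S"
        using CA by (auto simp: A_def)
      moreover have "T \<subseteq> S \<inter> \<Inter>F \<or> S \<inter> \<Inter>F \<subseteq> T"
        using calculation chain by blast
      moreover have "S \<inter> \<Inter>(insert T F) = T \<inter> (S \<inter> \<Inter>F)"
        by auto
      ultimately show ?case
        by (metis inf.absorb1 inf.absorb2 insertCI)
    qed auto
    have "S \<inter> \<Inter>C \<noteq> {}"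
    proof (rule compact_imp_fip[OF \<open>compact S\<close>])
      show "S \<inter> \<Inter>F \<noteq> {}" if "finite F" "F \<subseteq> C" for F
        using ClC[OF that] CA SA by (auto simp: A_def)
    qed (use closedC in auto)
    moreover have "compact (S \<inter> \<Inter>C)"
      using closedC \<open>compact S\<close> by (intro compact_Int_closed closed_Inter) auto
    moreover have "u \<circ> v \<in> S \<inter> \<Inter>C" if "u \<in> S \<inter> \<Inter>C" "v \<in> S \<inter> \<Inter>C" for u v
      using that assms(3) CA unfolding A_def by blast
    ultimately have "S \<inter> \<Inter>C \<in> A"
      by (auto simp: A_def)
    then show "\<exists>u\<in>A. \<forall>a\<in>C. u \<subseteq> a"
      by (rule bexI[rotated]) auto
  qed
  then obtain M where M: "M \<in> A" and min: "\<And>N. N \<in> A \<Longrightarrow> N \<subseteq> M \<Longrightarrow> N = M"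
    by blast
  show thesis
  proof (rule that[of M])
    show "N = M"
      if "N \<subseteq> M" "compact N" "N \<noteq> {}" "\<And>u v. u \<in> N \<Longrightarrow> v \<in> N \<Longrightarrow> u \<circ> v \<in> N" for N
    proof (rule min)
      show "N \<in> A"
        using that M by (simp add: A_def) blast
    qed (rule that(1))
  qed (use M in \<open>simp_all add: A_def\<close>)
qed

text \<open>
  The Ellis--Numakura lemma. In a minimal compact subsemigroup \<open>M\<close> every element \<open>u\<close> is idempotent: the
  subsemigroup \<open>M \<circ> u\<close> is all of \<open>M\<close>, hence \<open>w \<circ> u = u\<close> has a solution in \<open>M\<close>; the solutions form
  a compact subsemigroup, hence \<open>u\<close> itself is one of them.
\<close>

lemma compact_semigroup_idempotent:
  fixes S :: "('a \<Rightarrow> 'a::t2_space) set"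
  assumes "compact S" "S \<noteq> {}" "\<And>u v. u \<in> S \<Longrightarrow> v \<in> S \<Longrightarrow> u \<circ> v \<in> S"
  obtains u where "u \<in> S" "u \<circ> u = u"
proof -
  obtain M where M: "M \<subseteq> S" "compact M" "M \<noteq> {}" "\<And>u v. u \<in> M \<Longrightarrow> v \<in> M \<Longrightarrow> u \<circ> v \<in> M"
    and min: "\<And>N. N \<subseteq> M \<Longrightarrow> compact N \<Longrightarrow> N \<noteq> {} \<Longrightarrow>
        (\<And>u v. u \<in> N \<Longrightarrow> v \<in> N \<Longrightarrow> u \<circ> v \<in> N) \<Longrightarrow> N = M"
    using compact_semigroup_minimal[OF assms] by blast
  obtain u where u: "u \<in> M"
    using M by blast
  have "(\<lambda>q. q \<circ> u) ` M = M"
  proof (rule min)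
    show "compact ((\<lambda>q. q \<circ> u) ` M)"
      by (intro compact_continuous_image continuous_on_comp_right M)
    show "v \<circ> w \<in> (\<lambda>q. q \<circ> u) ` M"
      if vw: "v \<in> (\<lambda>q. q \<circ> u) ` M" "w \<in> (\<lambda>q. q \<circ> u) ` M" for v w
    proof -
      obtain a b where "a \<in> M" "b \<in> M" "v = a \<circ> u" "w = b \<circ> u"
        using vw by blast
      then have "v \<circ> w = (a \<circ> u \<circ> b) \<circ> u" "a \<circ> u \<circ> b \<in> M"
        using M(4) u by (auto simp: comp_assoc)
      then show ?thesis
        by blast
    qed
  qed (use M u in auto)
  then obtain w where w: "w \<in> M" "w \<circ> u = u"
    using u by (metis imageE)
  have "M \<inter> (\<lambda>q. q \<circ> u) -` {u} = M"
  proof (rule min)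
    have "closed {u}"
      by (rule compact_imp_closed_maps) simp
    then have "closed ((\<lambda>q. q \<circ> u) -` {u})"
      by (rule closed_vimage) (rule continuous_on_comp_right)
    then show "compact (M \<inter> (\<lambda>q. q \<circ> u) -` {u})"
      using M(2) by (rule compact_Int_closed[rotated])
    show "v \<circ> w \<in> M \<inter> (\<lambda>q. q \<circ> u) -` {u}"
      if "v \<in> M \<inter> (\<lambda>q. q \<circ> u) -` {u}" "w \<in> M \<inter> (\<lambda>q. q \<circ> u) -` {u}" for v w
      using that M(4) by (auto simp: comp_assoc)
  qed (use w in auto)
  then have "u \<circ> u = u"
    using u by auto
  then show thesis
    using that u M(1) by blast
qed

section \<open>Recurrence in distal systems\<close>

lemma funpow_invariant: "f ` X \<subseteq> X \<Longrightarrow> x \<in> X \<Longrightarrow> (f ^^ n) x \<in> X"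
  by (induction n) auto

text \<open>
  The semigroup to which the Ellis--Numakura lemma applies is the closure of the powers \<open>f\<^sup>n\<close> with
  \<open>n \<ge> m\<close>; already these powers form a semigroup, which is why the return time can be taken large.
\<close>

lemma distal_simultaneous_recurrence:
  fixes X :: "'a::metric_space set"
  assumes "compact X" and contf: "continuous_on X f" and fX: "f ` X \<subseteq> X"
    and dis: "\<And>x y. x \<in> X \<Longrightarrow> y \<in> X \<Longrightarrow> x \<noteq> y \<Longrightarrow> \<exists>e>0. \<forall>n. e \<le> dist ((f ^^ n) x) ((f ^^ n) y)"
    and A: "finite A" "A \<subseteq> X" and "e > 0"
  shows "\<exists>n\<ge>m. \<forall>a\<in>A. dist ((f ^^ n) a) a < e"
proof -
  \<comment> \<open>Redefining \<open>f\<close> as the identity outside \<open>X\<close> makes its powers members of the compact set \<open>K\<close> of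
    maps that preserve \<open>X\<close> and fix all other points.\<close>
  define F where "F x = (if x \<in> X then f x else x)" for x
  have Fin: "(F ^^ n) x = (f ^^ n) x" if "x \<in> X" for x n
    using that by (induction n) (auto simp: F_def funpow_invariant[OF fX])
  have Fout: "(F ^^ n) x = x" if "x \<notin> X" for x n
    using that by (induction n) (auto simp: F_def)
  have contF: "continuous_on X (F ^^ n)" for n
  proof (induction n)
    case (Suc n)
    have "continuous_on X F"
      using contf by (rule continuous_on_eq) (simp add: F_def)
    moreover have "(F ^^ n) ` X \<subseteq> X"
      using Fin funpow_invariant[OF fX] by auto
    ultimately show ?case
      using continuous_on_compose2[of X F X "F ^^ n"] Suc by (simp add: comp_def)
  qed (simp add: id_def)
  define K where "K = PiE UNIV (\<lambda>x. if x \<in> X then X else {x})"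
  have "compactin (product_topology (\<lambda>i::'a. euclidean::'a topology) UNIV) K"
    unfolding K_def compactin_PiE using \<open>compact X\<close> by simp
  then have K: "compact K"
    by (simp add: euclidean_product_topology)
  then have clK: "closed K"
    by (rule compact_imp_closed_maps)
  have K_iff: "q \<in> K \<longleftrightarrow> (\<forall>x. q x \<in> (if x \<in> X then X else {x}))" for q
    by (simp only: K_def PiE_UNIV_domain Pi_iff ball_UNIV)
  have KX: "q x \<in> X" if "q \<in> K" "x \<in> X" for q x
    using spec[OF iffD1[OF K_iff that(1)], of x] that(2) by simp
  have Kout: "q x = x" if "q \<in> K" "x \<notin> X" for q x
    using spec[OF iffD1[OF K_iff that(1)], of x] that(2) by simp
  define G where "G = (\<lambda>n. F ^^ n) ` {m..}"
  define E where "E = closure G"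
  have "G \<subseteq> K"
    using Fin Fout funpow_invariant[OF fX] by (auto simp: G_def K_iff)
  then have EK: "E \<subseteq> K"
    unfolding E_def using clK by (rule closure_minimal)
  have clE: "closed E"
    by (simp add: E_def)
  have "compact E"
    using compact_Int_closed[OF K clE] EK by (simp add: inf_absorb2)
  moreover have "E \<noteq> {}"
    by (auto simp: E_def G_def)
  moreover have "p \<circ> q \<in> E" if p: "p \<in> E" and q: "q \<in> E" for p q
  proof -
    \<comment> \<open>Composition with a fixed left factor is continuous only if that factor is. So the closure
      is taken first in the right factor, for a power of \<open>F\<close> on the left, and then in the left one.\<close>
    have left: "F ^^ n \<circ> r \<in> E" if "n \<ge> m" "r \<in> E" for n r
    proof -
      have "continuous_on K (\<lambda>r. F ^^ n \<circ> r)"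
      proof (rule continuous_on_coordinatewise_then_product)
        fix x
        show "continuous_on K (\<lambda>r. (F ^^ n \<circ> r) x)"
        proof (cases "x \<in> X")
          case True
          have "continuous_on K (\<lambda>r. r x)"
            by (rule continuous_on_subset[OF continuous_on_product_coordinates]) simp
          then show ?thesis
            using continuous_on_compose2[OF contF[of n]] KX True by fastforce
        next
          case False
          show ?thesis
            by (rule continuous_on_eq[OF continuous_on_const[of K x]]) (simp add: Kout Fout False)
        qed
      qed
      then have "closed (K \<inter> (\<lambda>r. F ^^ n \<circ> r) -` E)"
        using clK clE by (rule continuous_closed_preimage)
      moreover have "G \<subseteq> K \<inter> (\<lambda>r. F ^^ n \<circ> r) -` E"
      proof -
        have "F ^^ n \<circ> F ^^ k \<in> G" if "k \<ge> m" for k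
          using that \<open>n \<ge> m\<close> by (auto simp: G_def funpow_add[symmetric])
        then have "F ^^ n \<circ> F ^^ k \<in> E" if "k \<ge> m" for k
          using that closure_subset by (auto simp: E_def)
        then show ?thesis
          using \<open>G \<subseteq> K\<close> by (auto simp: G_def)
      qed
      ultimately have "E \<subseteq> K \<inter> (\<lambda>r. F ^^ n \<circ> r) -` E"
        unfolding E_def by (intro closure_minimal)
      then show ?thesis
        using that by auto
    qed
    have "closed ((\<lambda>r. r \<circ> q) -` E)"
      using clE by (rule closed_vimage) (rule continuous_on_comp_right)
    moreover have "G \<subseteq> (\<lambda>r. r \<circ> q) -` E"
      using left q by (auto simp: G_def)
    ultimately have "E \<subseteq> (\<lambda>r. r \<circ> q) -` E"
      unfolding E_def by (intro closure_minimal)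
    then show ?thesis
      using p by auto
  qed
  ultimately obtain u where u: "u \<in> E" "u \<circ> u = u"
    by (rule compact_semigroup_idempotent)
  have approx: "\<exists>n\<ge>m. \<forall>b\<in>B. dist ((f ^^ n) b) (u b) < d" if "finite B" "B \<subseteq> X" "d > 0" for B d
  proof -
    have "open {h. \<forall>b\<in>B. h b \<in> ball (u b) d}"
      using product_topology_basis'[OF \<open>finite B\<close>, of "\<lambda>b. ball (u b) d" "\<lambda>b. b"] by simp
    moreover have "u \<in> {h. \<forall>b\<in>B. h b \<in> ball (u b) d} \<inter> closure G"
      using u(1) \<open>d > 0\<close> by (simp add: E_def)
    ultimately obtain h where "h \<in> G" and h: "\<forall>b\<in>B. h b \<in> ball (u b) d"
      using open_Int_closure_eq_empty[of "{h. \<forall>b\<in>B. h b \<in> ball (u b) d}" G] by blast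
    then obtain n where "n \<ge> m" "h = F ^^ n"
      by (auto simp: G_def)
    then show ?thesis
      using h Fin \<open>B \<subseteq> X\<close> by (intro exI[of _ n]) (auto simp: dist_commute subset_eq)
  qed
  have "u x = x" if x: "x \<in> X" for x
  proof (rule ccontr)
    assume "u x \<noteq> x"
    have ux: "u x \<in> X"
      using u EK KX x by blast
    then obtain d where d: "d > 0" "\<And>n. d \<le> dist ((f ^^ n) x) ((f ^^ n) (u x))"
      using dis[of x "u x"] \<open>u x \<noteq> x\<close> x by metis
    obtain n where n: "\<forall>b\<in>{x, u x}. dist ((f ^^ n) b) (u b) < d / 2"
      using approx[of "{x, u x}" "d / 2"] x ux d(1) by auto
    have "u (u x) = u x"
      using u(2) by (metis comp_apply)
    then have "dist ((f ^^ n) x) ((f ^^ n) (u x)) < d"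
      using n dist_triangle_half_l by fastforce
    then show False
      using d(2)[of n] by simp
  qed
  then show ?thesis
    using approx[OF A \<open>e > 0\<close>] A(2) by (simp add: subset_eq)
qed

section \<open>Iterates of a homeomorphism\<close>

lemma homeomorphism_funpow_mem: "homeomorphism X X f g \<Longrightarrow> x \<in> X \<Longrightarrow> (f ^^ n) x \<in> X"
  by (rule funpow_invariant) (auto simp: homeomorphism_def)

lemma self_homeomorphism_inv_into:
  assumes "self_homeomorphism X f"
  shows "homeomorphism X X f (inv_into X f)"
proof -
  obtain g where g: "homeomorphism X X f g"
    using assms by (auto simp: self_homeomorphism_def)
  have "inv_into X f y = g y" if "y \<in> X" for y
  proof (rule inv_into_f_eq)
    show "inj_on f X"
      using g by (auto simp: homeomorphism_def intro: inj_on_inverseI)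
  qed (use g that in \<open>auto simp: homeomorphism_def\<close>)
  then show ?thesis
    using g by (auto intro: homeomorphism_cong)
qed

lemma inverse_funpow_cancel:
  assumes "homeomorphism X X f g" "x \<in> X" "n \<le> k"
  shows "(g ^^ k) ((f ^^ n) x) = (g ^^ (k - n)) x"
  using assms(3)
proof (induction n arbitrary: k)
  case (Suc n)
  then obtain j where k: "k = Suc j"
    by (metis Suc_le_D)
  have "(f ^^ n) x \<in> X"
    using assms(1,2) by (rule homeomorphism_funpow_mem)
  then have "g ((f ^^ Suc n) x) = (f ^^ n) x"
    using assms(1) by (simp add: homeomorphism_def)
  then have "(g ^^ k) ((f ^^ Suc n) x) = (g ^^ j) ((f ^^ n) x)"
    by (simp add: k funpow_swap1)
  then show ?case
    using Suc k by simp
qed simp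

lemma int_iterate_mem:
  assumes "homeomorphism X X f (inv_into X f)" "x \<in> X"
  shows "int_iterate X f n x \<in> X"
  using assms funpow_invariant[of f X x] funpow_invariant[of "inv_into X f" X x]
  by (auto simp: int_iterate_def homeomorphism_def)

lemma int_iterate_of_nat: "int_iterate X f (int n) = f ^^ n"
  by (simp add: int_iterate_def)

lemma int_iterate_minus_of_nat: "int_iterate X f (- int n) = inv_into X f ^^ n"
  by (cases n) (auto simp: int_iterate_def nat_add_distrib)

lemma int_iterate_step:
  assumes hom: "homeomorphism X X f (inv_into X f)" and x: "x \<in> X"
  shows "f (int_iterate X f n x) = int_iterate X f (n + 1) x"
proof (cases "0 \<le> n")
  case True
  then show ?thesis
    by (simp add: int_iterate_def nat_add_distrib)
next
  case False
  then obtain k where n: "n = - int (Suc k)"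
    by (metis not_le negD)
  have "(inv_into X f ^^ k) x \<in> X"
    using hom x int_iterate_mem[OF hom x, of "- int k"] by (simp add: int_iterate_minus_of_nat)
  then have "f ((inv_into X f ^^ Suc k) x) = (inv_into X f ^^ k) x"
    using hom by (simp add: homeomorphism_def)
  moreover have "n + 1 = - int k"
    by (simp add: n)
  ultimately show ?thesis
    by (simp only: n int_iterate_minus_of_nat)
qed

lemma distal_separated:
  assumes "distal X f" "x \<in> X" "y \<in> X" "x \<noteq> y"
  shows "\<exists>e>0. \<forall>n. e \<le> dist (int_iterate X f n x) (int_iterate X f n y)"
proof (intro exI conjI allI)
  let ?d = "\<lambda>n. dist (int_iterate X f n x) (int_iterate X f n y)"
  show "(INF n. ?d n) > 0"
    using assms by (auto simp: distal_def)
  show "(INF n. ?d n) \<le> ?d n" for n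
    by (rule cINF_lower) (auto intro: bdd_belowI2[of _ 0])
qed

section \<open>Pseudo-orbits along connected sets\<close>

text \<open>
  The set of endpoints \<open>b\<close> that can be reached is closed under jumps of length \<open>\<delta> / 2\<close>, which is all that
  connectedness requires. To pass from \<open>b\<close> to a nearby \<open>c\<close>, the pseudo-orbit follows the orbit of \<open>b\<close>
  until it is about to return close to \<open>b\<close> after \<open>n \<ge> 1\<close> steps, and jumps to \<open>c\<close> instead. The bound on \<open>f\<^sup>N p\<close> survives the lengthening
  of \<open>N\<close> by \<open>n\<close> because \<open>f\<^sup>N p\<close> is made to return together with \<open>b\<close>.
\<close>

lemma pseudo_orbit_along_connected:
  assumes hom: "homeomorphism X X f (inv_into X f)"
    and C: "connected C" "C \<subseteq> X" "p \<in> C" "b \<in> C"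
    and rec: "\<And>A e. finite A \<Longrightarrow> A \<subseteq> X \<Longrightarrow> e > 0 \<Longrightarrow> \<exists>n\<ge>1. \<forall>a\<in>A. dist ((f ^^ n) a) a < e"
    and "\<delta> > 0" "\<gamma> > 0"
  shows "\<exists>\<xi> N. pseudo_orbit X f \<delta> \<xi> \<and> (\<forall>t\<le>0. \<xi> t = int_iterate X f t p) \<and>
            (\<forall>t\<ge>int N. \<xi> t = (f ^^ nat (t - int N)) b) \<and> dist ((f ^^ N) p) p < \<gamma>"
    (is "?P b")
proof -
  have "p \<in> X"
    using C by blast
  show ?thesis
  proof (rule connected_induction_simple[OF C(1) C(3,4)])
    show "?P p"
    proof (intro exI[of _ "\<lambda>t. int_iterate X f t p"] exI[of _ 0] conjI)
      show "pseudo_orbit X f \<delta> (\<lambda>t. int_iterate X f t p)"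
        using int_iterate_step[OF hom \<open>p \<in> X\<close>] int_iterate_mem[OF hom \<open>p \<in> X\<close>] \<open>\<delta> > 0\<close>
        by (simp add: pseudo_orbit_def)
    qed (use \<open>\<gamma> > 0\<close> in \<open>auto simp: int_iterate_def\<close>)
  next
    fix a assume "a \<in> C"
    have step: "?P c" if b: "b \<in> C \<inter> ball a (\<delta> / 4)" and c: "c \<in> C \<inter> ball a (\<delta> / 4)" and Pb: "?P b" for b c
    proof -
      have bX: "b \<in> X" and cX: "c \<in> X"
        using b c C by auto
      have bc: "dist b c < \<delta> / 2"
        using b c dist_triangle_half_r[of a b "\<delta> / 2" c] by auto
      obtain \<xi> N where \<xi>: "pseudo_orbit X f \<delta> \<xi>" and past: "\<And>t. t \<le> 0 \<Longrightarrow> \<xi> t = int_iterate X f t p"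
        and future: "\<And>t. t \<ge> int N \<Longrightarrow> \<xi> t = (f ^^ nat (t - int N)) b"
        and N: "dist ((f ^^ N) p) p < \<gamma>"
        using Pb by blast
      have NX: "(f ^^ N) p \<in> X"
        using hom \<open>p \<in> X\<close> by (rule homeomorphism_funpow_mem)
      \<comment> \<open>The second bound is what is left of \<open>\<gamma>\<close> for \<open>f\<^sup>N p\<close> to move.\<close>
      define e where "e = min (\<delta> / 2) (\<gamma> - dist ((f ^^ N) p) p)"
      obtain n where n: "n \<ge> 1" "\<forall>x\<in>{b, (f ^^ N) p}. dist ((f ^^ n) x) x < e"
        using rec[of "{b, (f ^^ N) p}" e] bX NX N \<open>\<delta> > 0\<close> by (auto simp: e_def)
      define L where "L = n + N"
      define \<eta> where "\<eta> t = (if t < int L then \<xi> t else (f ^^ nat (t - int L)) c)" for t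
      have "\<eta> t \<in> X" for t
        using \<xi> funpow_invariant[of f X c] cX hom
        by (auto simp: \<eta>_def pseudo_orbit_def homeomorphism_def)
      moreover have "dist (f (\<eta> t)) (\<eta> (t + 1)) \<le> \<delta>" for t
      proof -
        consider "t + 1 < int L" | "t + 1 = int L" | "t \<ge> int L"
          by linarith
        then show ?thesis
        proof cases
          case 1
          then show ?thesis
            using \<xi> by (simp add: \<eta>_def pseudo_orbit_def)
        next
          case 2
          have "t \<ge> int N" "nat (t - int N) = n - 1"
            using 2 n(1) by (auto simp: L_def)
          then have "f (\<eta> t) = (f ^^ Suc (n - 1)) b"
            using 2 future by (simp add: \<eta>_def)
          then have "f (\<eta> t) = (f ^^ n) b" "\<eta> (t + 1) = c"
            using 2 n(1) by (auto simp: \<eta>_def)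
          moreover have "dist ((f ^^ n) b) b < \<delta> / 2"
            using n(2) by (simp add: e_def)
          ultimately show ?thesis
            using bc dist_triangle[of "(f ^^ n) b" c b] by simp
        next
          case 3
          then have "nat (t + 1 - int L) = Suc (nat (t - int L))"
            by linarith
          then show ?thesis
            using 3 \<open>\<delta> > 0\<close> by (simp add: \<eta>_def)
        qed
      qed
      ultimately have "pseudo_orbit X f \<delta> \<eta>"
        by (simp add: pseudo_orbit_def)
      moreover have "\<eta> t = int_iterate X f t p" if "t \<le> 0" for t
        using that n(1) past by (simp add: \<eta>_def L_def)
      moreover have "\<eta> t = (f ^^ nat (t - int L)) c" if "t \<ge> int L" for t
        using that by (simp add: \<eta>_def)
      moreover have "dist ((f ^^ L) p) p < \<gamma>"
      proof -
        have "dist ((f ^^ L) p) ((f ^^ N) p) < e"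
          using n(2) by (simp add: L_def funpow_add)
        then show ?thesis
          using dist_triangle[of "(f ^^ L) p" p "(f ^^ N) p"] by (simp add: e_def)
      qed
      ultimately show ?thesis
        by blast
    qed
    show "\<exists>T. openin (top_of_set C) T \<and> a \<in> T \<and> (\<forall>x\<in>T. \<forall>y\<in>T. ?P x \<longrightarrow> ?P y)"
    proof (rule exI[of _ "C \<inter> ball a (\<delta> / 4)"], intro conjI)
      show "openin (top_of_set C) (C \<inter> ball a (\<delta> / 4))"
        by (simp add: openin_open_Int)
      show "a \<in> C \<inter> ball a (\<delta> / 4)"
        using \<open>a \<in> C\<close> \<open>\<delta> > 0\<close> by simp
      show "\<forall>x\<in>C \<inter> ball a (\<delta> / 4). \<forall>y\<in>C \<inter> ball a (\<delta> / 4). ?P x \<longrightarrow> ?P y"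
        by (intro ballI impI) (rule step)
    qed
  qed
qed

theorem corollary1p7:
  fixes X :: "'a::metric_space set"
  assumes "compact X"
    and "\<exists>f. self_homeomorphism X f \<and> distal X f \<and> POTP X f"
  shows "totally_disconnected X"
proof -
  obtain f where f: "self_homeomorphism X f" "distal X f" "POTP X f"
    using assms(2) by blast
  define g where "g = inv_into X f"
  have hom: "homeomorphism X X f g"
    unfolding g_def using f(1) by (rule self_homeomorphism_inv_into)
  have fX: "f ` X \<subseteq> X" and gX: "g ` X \<subseteq> X"
    using hom by (auto simp: homeomorphism_def)
  have recf: "\<exists>n\<ge>m. \<forall>a\<in>A. dist ((f ^^ n) a) a < e" if "finite A" "A \<subseteq> X" "e > 0" for A e m
  proof -
    have "\<exists>e>0. \<forall>n. e \<le> dist ((f ^^ n) x) ((f ^^ n) y)" if "x \<in> X" "y \<in> X" "x \<noteq> y" for x y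
      using distal_separated[OF f(2) that] by (metis int_iterate_of_nat)
    then show ?thesis
      by (rule distal_simultaneous_recurrence[OF assms(1) homeomorphism_cont1[OF hom] fX _ that])
  qed
  have recg: "\<exists>n\<ge>m. \<forall>a\<in>A. dist ((g ^^ n) a) a < e" if "finite A" "A \<subseteq> X" "e > 0" for A e m
  proof -
    have "\<exists>e>0. \<forall>n. e \<le> dist ((g ^^ n) x) ((g ^^ n) y)" if "x \<in> X" "y \<in> X" "x \<noteq> y" for x y
      using distal_separated[OF f(2) that] unfolding g_def by (metis int_iterate_minus_of_nat)
    then show ?thesis
      by (rule distal_simultaneous_recurrence[OF assms(1) homeomorphism_cont2[OF hom] gX _ that])
  qed
  have "b = p" if "p \<in> X" and b: "b \<in> connected_component_set X p" for p b
  proof (rule ccontr)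
    assume "b \<noteq> p"
    define C where "C = connected_component_set X p"
    have C: "connected C" "C \<subseteq> X" "p \<in> C" "b \<in> C"
      using that connected_component_subset[of X p] by (auto simp: C_def)
    \<comment> \<open>The path from \<open>p\<close> to \<open>b\<close> via \<open>f\<^sup>N p\<close>, its return, the return of \<open>f\<^sup>N x\<close>, and \<open>f\<^sup>N x\<close> itself
      has five parts.\<close>
    define \<epsilon> where "\<epsilon> = dist p b / 5"
    have "\<epsilon> > 0"
      using \<open>b \<noteq> p\<close> by (simp add: \<epsilon>_def)
    then obtain \<delta> where "\<delta> > 0"
      and shadow: "\<And>\<xi>. pseudo_orbit X f \<delta> \<xi> \<Longrightarrow> can_be_shadowed X f \<epsilon> \<xi>"
      using f(3) by (metis POTP_def)
    obtain \<xi> N where \<xi>: "pseudo_orbit X f \<delta> \<xi>"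
      and past: "\<And>t. t \<le> 0 \<Longrightarrow> \<xi> t = int_iterate X f t p"
      and future: "\<And>t. t \<ge> int N \<Longrightarrow> \<xi> t = (f ^^ nat (t - int N)) b"
      and N: "dist ((f ^^ N) p) p < \<epsilon>"
      using pseudo_orbit_along_connected[OF hom[unfolded g_def] C
          recf[where m = 1] \<open>\<delta> > 0\<close> \<open>\<epsilon> > 0\<close>] by blast
    obtain x where "x \<in> X" and x: "\<And>t. dist (int_iterate X f t x) (\<xi> t) \<le> \<epsilon>"
      using shadow[OF \<xi>] by (auto simp: can_be_shadowed_def)
    have "\<xi> (int N) = b"
      using future[of "int N"] by simp
    then have xb: "dist ((f ^^ N) x) b \<le> \<epsilon>"
      using x[of "int N"] by (simp add: int_iterate_of_nat)
    have shadow_past: "dist ((g ^^ k) x) ((g ^^ k) p) \<le> \<epsilon>" for k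
      using x[of "- int k"] past[of "- int k"] by (simp add: int_iterate_minus_of_nat g_def)
    have "(f ^^ N) x \<in> X" "(f ^^ N) p \<in> X"
      using funpow_invariant[OF fX] \<open>x \<in> X\<close> \<open>p \<in> X\<close> by auto
    \<comment> \<open>As \<open>k \<ge> N\<close>, the returning points lie on the backward orbits of \<open>x\<close> and \<open>p\<close>.\<close>
    then obtain k where k: "k \<ge> N" "\<forall>a\<in>{(f ^^ N) x, (f ^^ N) p}. dist ((g ^^ k) a) a < \<epsilon>"
      using recg[of "{(f ^^ N) x, (f ^^ N) p}" \<epsilon> N] \<open>\<epsilon> > 0\<close> by auto
    then have "dist ((g ^^ (k - N)) x) ((f ^^ N) x) < \<epsilon>" "dist ((g ^^ (k - N)) p) ((f ^^ N) p) < \<epsilon>"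
      using inverse_funpow_cancel[OF hom] \<open>x \<in> X\<close> \<open>p \<in> X\<close> by auto
    then have "dist p b < 5 * \<epsilon>"
      using shadow_past[of "k - N"] xb N by metric
    then show False
      by (simp add: \<epsilon>_def)
  qed
  then show ?thesis
    unfolding totally_disconnected_def by (auto intro: connected_component_refl)
qed

end
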